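(* Let $G$ be a simple graph with vertex set $\{v_1,\dots,v_n\}$ and let $J$ be a symmetric subgraph of $K_{n,n}$. Suppose that for all $i\neq j$ with $i,j\in\{1,\dots,n\}$, $J$ does not contain both the edge $(i,i')$ and the pair of edges $(i,j'),(j,i')$. Then $\chi_\infty(G,J)\le 2n$.
   Context: Let $K_{n,n}$ be the complete bipartite graph with parts $I_n=\{1,\dots,n\}$ and $I_n'=\{1',\dots,n'\}$; a subgraph $J$ of $K_{n,n}$ with vertex set $I_n\cup I_n'$ is symmetric if $i\sim j'$ iff $j\sim i'$. The self-similar graphs based on $(G,J)$: $G^1=G$; for $k\ge2$, $V(G^k)=V(G)^k$, and $(v_{i_1},\dots,v_{i_k})\sim(v_{j_1},\dots,v_{j_k})$ in $G^k$ iff either (1) $(v_{i_1},\dots,v_{i_{k-1}})=(v_{j_1},\dots,v_{j_{k-1}})$ and $v_{i_k}\sim v_{j_k}$ in $G$, or (2) $(v_{i_1},\dots,v_{i_{k-1}})\sim(v_{j_1},\dots,v_{j_{k-1}})$ in $G^{k-1}$ and $i_k\sim j_k'$ in $J$. The sequence $\chi(G^k)$ is non-decreasing; $\chi_\infty(G,J)$ denotes its limit, with $\chi_\infty(G,J)=\infty$ if it is unbounded. *)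

theory Defs
  imports "Graph_Theory.Graph_Theory" "HOL-Library.Extended_Real"
begin

text \<open>
  Simple graphs are finite, symmetric, loop-free digraphs (\<open>pair_graph\<close>); an undirected edge
  \<open>u v\<close> is the pair of arcs \<open>(u,v)\<close>, \<open>(v,u)\<close>.
\<close>

definition proper_colouring :: "'a pair_pre_digraph \<Rightarrow> nat \<Rightarrow> ('a \<Rightarrow> nat) \<Rightarrow> bool" where
  "proper_colouring G m c \<longleftrightarrow>
     c ` pverts G \<subseteq> {..<m} \<and> (\<forall>(u, w) \<in> parcs G. c u \<noteq> c w)"

text \<open>The infimum is taken in \<^typ>\<open>enat\<close>, so a graph without finite colouring gets \<open>\<infinity>\<close>.\<close>

definition chromatic_number :: "'a pair_pre_digraph \<Rightarrow> enat" where
  "chromatic_number G = (INF m \<in> {m. \<exists>c. proper_colouring G m c}. enat m)"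

text \<open>The vertices \<open>i\<close> and \<open>j'\<close> of \<open>K\<^sub>n\<^sub>,\<^sub>n\<close> are \<open>Inl i\<close> and \<open>Inr j\<close>.\<close>

definition Knn :: "nat \<Rightarrow> (nat + nat) pair_pre_digraph" where
  "Knn n = \<lparr> pverts = Inl ` {1..n} \<union> Inr ` {1..n},
             parcs = (Inl ` {1..n}) \<times> (Inr ` {1..n}) \<union> (Inr ` {1..n}) \<times> (Inl ` {1..n}) \<rparr>"

definition symmetric_subgraph_Knn :: "nat \<Rightarrow> (nat + nat) pair_pre_digraph \<Rightarrow> bool" where
  "symmetric_subgraph_Knn n J \<longleftrightarrow>
     pair_graph J \<and> spanning (with_proj J) (with_proj (Knn n)) \<and>
     (\<forall>i \<in> {1..n}. \<forall>j \<in> {1..n}. (Inl i, Inr j) \<in> parcs J \<longleftrightarrow> (Inl j, Inr i) \<in> parcs J)"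

text \<open>
  \<open>self_similar n v G J k\<close> is \<open>G\<^sup>k\<close> for a graph \<open>G\<close> with vertices \<open>v 1, \<dots>, v n\<close>; the vertex
  \<open>(x\<^sub>1, \<dots>, x\<^sub>k)\<close> is the list \<open>[x\<^sub>1, \<dots>, x\<^sub>k]\<close>. In particular \<open>G\<^sup>1\<close> is \<open>G\<close> with \<open>x\<close> written
  as \<open>[x]\<close>. The value at \<open>0\<close> is a dummy: only \<open>k \<ge> 1\<close> is meaningful.
\<close>

fun self_similar ::
  "nat \<Rightarrow> (nat \<Rightarrow> 'a) \<Rightarrow> 'a pair_pre_digraph \<Rightarrow> (nat + nat) pair_pre_digraph \<Rightarrow> nat
     \<Rightarrow> 'a list pair_pre_digraph" where
  "self_similar n v G J 0 = \<lparr> pverts = {[]}, parcs = {} \<rparr>"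
| "self_similar n v G J (Suc 0) =
     \<lparr> pverts = {[x] | x. x \<in> pverts G}, parcs = {([x], [y]) | x y. (x, y) \<in> parcs G} \<rparr>"
| "self_similar n v G J (Suc (Suc k)) =
     \<lparr> pverts = {ws. length ws = Suc (Suc k) \<and> set ws \<subseteq> pverts G},
       parcs = {(xs @ [v i], ys @ [v j]) | xs ys i j.
                  xs \<in> pverts (self_similar n v G J (Suc k)) \<and>
                  ys \<in> pverts (self_similar n v G J (Suc k)) \<and>
                  i \<in> {1..n} \<and> j \<in> {1..n} \<and>
                  (xs = ys \<and> (v i, v j) \<in> parcs G \<or>
                   (xs, ys) \<in> parcs (self_similar n v G J (Suc k)) \<and> (Inl i, Inr j) \<in> parcs J)} \<rparr>"

text \<open>The limit is taken in the order topology of \<^typ>\<open>enat\<close>, so it is \<open>\<infinity>\<close> when the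
  (non-decreasing) sequence is unbounded.\<close>

definition chi_infinity ::
  "nat \<Rightarrow> (nat \<Rightarrow> 'a) \<Rightarrow> 'a pair_pre_digraph \<Rightarrow> (nat + nat) pair_pre_digraph \<Rightarrow> enat" where
  "chi_infinity n v G J = lim (\<lambda>k. chromatic_number (self_similar n v G J k))"

end

theory Submission
  imports Defs "HOL-Number_Theory.Cong"
begin

text \<open>
  Call a letter \<open>i\<close> looped if \<open>(i, i')\<close> is an edge of \<open>J\<close>. By hypothesis, \<open>J\<close> joins a looped letter
  only to itself, so an edge \<open>(i, j')\<close> of \<open>J\<close> has either \<open>i = j\<close> looped, or \<open>i \<noteq> j\<close> both unlooped.
  Read a word from left to right, keeping the parity of the number of unlooped letters and a
  residue modulo \<open>n\<close>: an unlooped letter overwrites the residue, a looped letter is added to it.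
  These \<open>2 n\<close> states colour every \<open>G\<^sup>k\<close> properly. At the first position where two adjacent words
  differ, the states become different; a later common looped letter acts injectively on states, and
  two different unlooped letters make the residues different. Prefixing a fixed vertex embeds \<open>G\<^sup>k\<close>
  into \<open>G\<^sup>k\<^sup>+\<^sup>1\<close>, hence the chromatic numbers converge.
\<close>

lemma chromatic_number_le:
  assumes "proper_colouring G m c"
  shows "chromatic_number G \<le> enat m"
  unfolding chromatic_number_def using assms by (auto intro!: INF_lower)

lemma chromatic_number_mono:
  assumes "\<And>m c. proper_colouring H m c \<Longrightarrow> \<exists>c'. proper_colouring G m c'"
  shows "chromatic_number G \<le> chromatic_number H"
  unfolding chromatic_number_def using assms by (intro INF_superset_mono) auto

lemma pverts_self_similar_Suc:
  "pverts (self_similar n v G J (Suc k)) = {ws. length ws = Suc k \<and> set ws \<subseteq> pverts G}"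
  by (cases k) (auto simp: length_Suc_conv)

text \<open>The recursion changes only the last letter, so a new first letter preserves both kinds
  of arc: equal prefixes stay equal, and adjacent prefixes stay adjacent by induction. In the base
  case \<open>[a]\<close> becomes the common prefix.\<close>

lemma arcs_self_similar_Cons:
  assumes "a \<in> pverts G" "bij_betw v {1..n} (pverts G)"
    and "(xs, ys) \<in> parcs (self_similar n v G J (Suc k))"
    and "pair_graph G"
  shows "(a # xs, a # ys) \<in> parcs (self_similar n v G J (Suc (Suc k)))"
  using assms(3)
proof (induction k arbitrary: xs ys)
  case 0
  then obtain x y where xy: "xs = [x]" "ys = [y]" "(x, y) \<in> parcs G"
    by auto
  interpret pair_graph G by fact
  have "x \<in> pverts G" "y \<in> pverts G"
    using xy(3) by (auto dest: in_arcsD1 in_arcsD2)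
  then obtain i j where "i \<in> {1..n}" "x = v i" "j \<in> {1..n}" "y = v j"
    using assms(2) unfolding bij_betw_def by (metis imageE)
  then have "a # xs = [a] @ [v i]" "a # ys = [a] @ [v j]" "i \<in> {1..n}" "j \<in> {1..n}"
    "(v i, v j) \<in> parcs G" "[a] \<in> pverts (self_similar n v G J (Suc 0))"
    using xy assms(1) by auto
  then show ?case
    unfolding self_similar.simps(3) pair_pre_digraph.simps by blast
next
  case (Suc k)
  from Suc.prems obtain us ws i j where *:
    "xs = us @ [v i]" "ys = ws @ [v j]"
    "us \<in> pverts (self_similar n v G J (Suc k))" "ws \<in> pverts (self_similar n v G J (Suc k))"
    "i \<in> {1..n}" "j \<in> {1..n}"
    "us = ws \<and> (v i, v j) \<in> parcs G \<or>
     (us, ws) \<in> parcs (self_similar n v G J (Suc k)) \<and> (Inl i, Inr j) \<in> parcs J"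
    by (auto simp only: self_similar.simps(3) pair_pre_digraph.simps mem_Collect_eq prod.inject)
  have "a # us \<in> pverts (self_similar n v G J (Suc (Suc k)))"
    "a # ws \<in> pverts (self_similar n v G J (Suc (Suc k)))"
    using *(3,4) assms(1) unfolding pverts_self_similar_Suc by auto
  moreover have "a # us = a # ws \<and> (v i, v j) \<in> parcs G \<or>
      (a # us, a # ws) \<in> parcs (self_similar n v G J (Suc (Suc k))) \<and> (Inl i, Inr j) \<in> parcs J"
    using *(7) Suc.IH by blast
  moreover have "a # xs = (a # us) @ [v i]" "a # ys = (a # ws) @ [v j]"
    using *(1,2) by auto
  ultimately show ?case
    using *(5,6) unfolding self_similar.simps(3)[of n v G J "Suc k"] pair_pre_digraph.simps
    by blast
qed

lemma chromatic_number_self_similar_Suc_le: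
  assumes "pair_graph G" "bij_betw v {1..n} (pverts G)"
  shows "chromatic_number (self_similar n v G J (Suc k)) \<le>
         chromatic_number (self_similar n v G J (Suc (Suc k)))"
proof (rule chromatic_number_mono)
  fix m c
  assume c: "proper_colouring (self_similar n v G J (Suc (Suc k))) m c"
  show "\<exists>c'. proper_colouring (self_similar n v G J (Suc k)) m c'"
  \<comment> \<open>Without vertices there is nothing to prefix, but then every power is empty and
    any colouring is proper.\<close>
  proof (cases "pverts G = {}")
    case True
    interpret pair_graph G by fact
    have "parcs G = {}"
      using True by (auto dest: in_arcsD1)
    moreover have "{1..n} = {}"
      using True assms(2) unfolding bij_betw_def by blast
    ultimately have "parcs (self_similar n v G J (Suc k)) = {}"
      by (cases k) auto
    moreover have "pverts (self_similar n v G J (Suc k)) = {}"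
      using True unfolding pverts_self_similar_Suc by auto
    ultimately show ?thesis
      unfolding proper_colouring_def by auto
  next
    case False
    then obtain a where a: "a \<in> pverts G" by blast
    have "proper_colouring (self_similar n v G J (Suc k)) m (\<lambda>xs. c (a # xs))"
      unfolding proper_colouring_def
    proof (intro conjI)
      show "(\<lambda>xs. c (a # xs)) ` pverts (self_similar n v G J (Suc k)) \<subseteq> {..<m}"
        using c a unfolding proper_colouring_def pverts_self_similar_Suc
        by (auto simp del: self_similar.simps simp: image_subset_iff)
      show "\<forall>(us, ws) \<in> parcs (self_similar n v G J (Suc k)). c (a # us) \<noteq> c (a # ws)"
        using c arcs_self_similar_Cons[OF a assms(2) _ assms(1)]
        unfolding proper_colouring_def by blast
    qed
    then show ?thesis by blast
  qed
qed

lemma chi_infinity_leI: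
  assumes "pair_graph G" "bij_betw v {1..n} (pverts G)"
    and "\<And>k. chromatic_number (self_similar n v G J (Suc k)) \<le> b"
  shows "chi_infinity n v G J \<le> b"
proof -
  let ?f = "\<lambda>k. chromatic_number (self_similar n v G J k)"
  \<comment> \<open>Index \<open>0\<close> carries a dummy graph, so monotonicity is used only from
    \<open>1\<close> on; the shift leaves the limit unchanged.\<close>
  have "incseq (\<lambda>k. ?f (Suc k))"
    using chromatic_number_self_similar_Suc_le[OF assms(1,2)] by (intro incseq_SucI)
  then have "(\<lambda>k. ?f (Suc k)) \<longlonglongrightarrow> (SUP k. ?f (Suc k))"
    by (rule LIMSEQ_SUP)
  then have "?f \<longlonglongrightarrow> (SUP k. ?f (Suc k))"
    by (rule LIMSEQ_imp_Suc)
  then have "chi_infinity n v G J = (SUP k. ?f (Suc k))"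
    unfolding chi_infinity_def by (rule limI)
  also have "\<dots> \<le> b"
    using assms(3) by (intro SUP_least)
  finally show ?thesis .
qed

text \<open>\<open>L\<close> is the set of looped letters; \<open>b\<close> is the parity and
  \<open>s\<close> the residue. The letter \<open>n\<close> has residue \<open>0\<close>.\<close>

fun letter_step :: "nat \<Rightarrow> nat set \<Rightarrow> bool \<times> nat \<Rightarrow> nat \<Rightarrow> bool \<times> nat" where
  "letter_step n L (b, s) i = (if i \<in> L then (b, (s + i) mod n) else (\<not> b, i mod n))"

definition word_state :: "nat \<Rightarrow> nat set \<Rightarrow> nat list \<Rightarrow> bool \<times> nat" where
  "word_state n L ws = foldl (letter_step n L) (False, 0) ws"

lemma word_state_snoc: "word_state n L (ws @ [i]) = letter_step n L (word_state n L ws) i"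
  by (simp add: word_state_def)

lemma snd_word_state_less: "0 < n \<Longrightarrow> snd (word_state n L ws) < n"
proof (induction ws rule: rev_induct)
  case Nil
  then show ?case by (simp add: word_state_def)
next
  case (snoc i ws)
  then show ?case by (cases "word_state n L ws") (simp add: word_state_snoc)
qed

lemma mod_add_left_inj_interval:
  fixes s i j n :: nat
  assumes "i \<in> {1..n}" "j \<in> {1..n}" "(s + i) mod n = (s + j) mod n"
  shows "i = j"
proof -
  have "i mod n = j mod n"
    using assms(3) cong_add_lcancel_nat[of s i j n] by (simp add: cong_def)
  then show ?thesis
    using assms(1,2) by (cases "i = n"; cases "j = n") auto
qed

text \<open>If exactly one letter is looped, only the other flips the parity, so the parities
  differ. Otherwise the residues differ: the letters are shifted by \<open>0\<close> if both are
  unlooped, by \<open>snd p\<close> if both are looped.\<close>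

lemma letter_step_neq_letter:
  assumes "i \<in> {1..n}" "j \<in> {1..n}" "i \<noteq> j"
  shows "letter_step n L p i \<noteq> letter_step n L p j"
  using assms mod_add_left_inj_interval[of i n j 0] mod_add_left_inj_interval[of i n j "snd p"]
  by (cases p) auto

text \<open>A looped letter keeps the parity and translates the residue, and translation modulo
  \<open>n\<close> is injective on reduced residues.\<close>

lemma letter_step_neq_state:
  assumes "i \<in> L" "snd p < n" "snd q < n" "p \<noteq> q"
  shows "letter_step n L p i \<noteq> letter_step n L q i"
  using assms cong_add_rcancel_nat[of "snd p" i "snd q" n]
  by (cases p; cases q) (auto simp: cong_def)

text \<open>An unlooped letter forgets the old residue, so the states before it may be
  arbitrary.\<close>

lemma letter_step_neq_unlooped:
  assumes "i \<in> {1..n}" "j \<in> {1..n}" "i \<noteq> j" "i \<notin> L" "j \<notin> L"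
  shows "letter_step n L p i \<noteq> letter_step n L q j"
  using assms mod_add_left_inj_interval[of i n j 0] by (cases p; cases q) auto

definition state_colour :: "bool \<times> nat \<Rightarrow> nat" where
  "state_colour p = 2 * snd p + of_bool (fst p)"

lemma state_colour_inj: "state_colour p = state_colour q \<Longrightarrow> p = q"
  unfolding state_colour_def by (cases p; cases q) (auto simp: of_bool_def split: if_splits, presburger+)

lemma state_colour_less: "snd p < n \<Longrightarrow> state_colour p < 2 * n"
  unfolding state_colour_def by (auto simp: of_bool_def)

lemma word_state_neq_of_arc:
  fixes v :: "nat \<Rightarrow> 'a"
  assumes "pair_graph G" "bij_betw v {1..n} (pverts G)"
    and looped: "\<And>i j. i \<in> {1..n} \<Longrightarrow> j \<in> {1..n} \<Longrightarrow> (Inl i, Inr j) \<in> parcs J \<Longrightarrow>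
           i = j \<and> i \<in> L \<or> i \<noteq> j \<and> i \<notin> L \<and> j \<notin> L"
    and "(xs, ys) \<in> parcs (self_similar n v G J (Suc k))"
  defines "idx \<equiv> inv_into {1..n} v"
  shows "word_state n L (map idx xs) \<noteq> word_state n L (map idx ys)"
  using assms(4)
proof (induction k arbitrary: xs ys)
  case 0
  then obtain x y where xy: "xs = [x]" "ys = [y]" "(x, y) \<in> parcs G"
    by auto
  interpret pair_graph G by fact
  have "x \<in> pverts G" "y \<in> pverts G" "x \<noteq> y"
    using xy(3) by (auto dest: in_arcsD1 in_arcsD2 no_loops')
  then obtain i j where "i \<in> {1..n}" "x = v i" "j \<in> {1..n}" "y = v j" "i \<noteq> j"
    using assms(2) unfolding bij_betw_def by (metis imageE)
  then have "idx x \<in> {1..n}" "idx y \<in> {1..n}" "idx x \<noteq> idx y"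
    using assms(2) unfolding bij_betw_def idx_def by (metis inv_into_f_f)+
  then show ?case
    using letter_step_neq_letter xy(1,2) word_state_snoc[of n L "[]"] by simp
next
  case (Suc k)
  from Suc.prems obtain us ws i j where *:
    "xs = us @ [v i]" "ys = ws @ [v j]" "i \<in> {1..n}" "j \<in> {1..n}"
    "us = ws \<and> (v i, v j) \<in> parcs G \<or>
     (us, ws) \<in> parcs (self_similar n v G J (Suc k)) \<and> (Inl i, Inr j) \<in> parcs J"
    by (auto simp only: self_similar.simps(3) pair_pre_digraph.simps mem_Collect_eq prod.inject)
  interpret pair_graph G by fact
  have idx: "idx (v i) = i" "idx (v j) = j"
    using *(3,4) assms(2) unfolding bij_betw_def idx_def by (metis inv_into_f_f)+
  have n: "0 < n" using *(3) by simp
  let ?s = "\<lambda>ws. word_state n L (map idx ws)"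
  have "letter_step n L (?s us) i \<noteq> letter_step n L (?s ws) j"
    using *(5)
  proof (elim disjE conjE)
    assume "us = ws" "(v i, v j) \<in> parcs G"
    then show ?thesis
      using letter_step_neq_letter[OF *(3,4)] no_loops' by metis
  next
    assume arc: "(us, ws) \<in> parcs (self_similar n v G J (Suc k))" and "(Inl i, Inr j) \<in> parcs J"
    then show ?thesis
      \<comment> \<open>Either a common looped letter preserves the difference given by induction,
        or two distinct unlooped letters create one by themselves.\<close>
      using looped[OF *(3,4)] letter_step_neq_state[OF _ _ _ Suc.IH[OF arc]]
        letter_step_neq_unlooped[OF *(3,4)] snd_word_state_less[OF n] by metis
  qed
  then show ?case
    using *(1,2) idx by (simp add: word_state_snoc)
qed

theorem theorem3p5:
  fixes n :: nat and v :: "nat \<Rightarrow> 'a"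
    and G :: "'a pair_pre_digraph" and J :: "(nat + nat) pair_pre_digraph"
  assumes "pair_graph G"
    and "bij_betw v {1..n} (pverts G)"
    and "symmetric_subgraph_Knn n J"
    and "\<And>i j. i \<in> {1..n} \<Longrightarrow> j \<in> {1..n} \<Longrightarrow> i \<noteq> j \<Longrightarrow>
           \<not> ((Inl i, Inr i) \<in> parcs J \<and> (Inl i, Inr j) \<in> parcs J \<and> (Inl j, Inr i) \<in> parcs J)"
  shows "chi_infinity n v G J \<le> enat (2 * n)"
proof (rule chi_infinity_leI[OF assms(1,2)])
  fix k
  define L where "L = {i. (Inl i, Inr i) \<in> parcs J}"
  have looped: "i = j \<and> i \<in> L \<or> i \<noteq> j \<and> i \<notin> L \<and> j \<notin> L"
    if "i \<in> {1..n}" "j \<in> {1..n}" "(Inl i, Inr j) \<in> parcs J" for i j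
  proof -
    have "(Inl j, Inr i) \<in> parcs J"
      using assms(3) that unfolding symmetric_subgraph_Knn_def by blast
    \<comment> \<open>With both crossing edges present for \<open>i \<noteq> j\<close>, a loop at
      either end is the forbidden configuration; hence the hypothesis is taken in both
      orders.\<close>
    then show ?thesis
      using that assms(4)[of i j] assms(4)[of j i] unfolding L_def by auto
  qed
  let ?c = "\<lambda>ws. state_colour (word_state n L (map (inv_into {1..n} v) ws))"
  have "?c ws < 2 * n" if ws: "ws \<in> pverts (self_similar n v G J (Suc k))" for ws
  proof -
    \<comment> \<open>Words here are nonempty, so a word exists only if \<open>n\<close> is
      positive, which makes residues modulo \<open>n\<close> smaller than \<open>n\<close>.\<close>
    have "pverts G \<noteq> {}"
      using ws unfolding pverts_self_similar_Suc by (cases ws) auto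
    then have "0 < n"
      using assms(2) unfolding bij_betw_def by (cases n) auto
    then show ?thesis
      by (intro state_colour_less snd_word_state_less)
  qed
  moreover have "?c xs \<noteq> ?c ys" if "(xs, ys) \<in> parcs (self_similar n v G J (Suc k))" for xs ys
    using word_state_neq_of_arc[OF assms(1,2) looped that] state_colour_inj by blast
  ultimately have "proper_colouring (self_similar n v G J (Suc k)) (2 * n) ?c"
    unfolding proper_colouring_def by blast
  then show "chromatic_number (self_similar n v G J (Suc k)) \<le> enat (2 * n)"
    by (rule chromatic_number_le)
qed

end
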